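(* Let $a,q\in\mathbb{Z}$ with $q>0$, $a\neq 0$ and $\gcd(a,q)=1$. Let $[b_0;b_1,\dots,b_k]$ be the continued fraction expansion of $a/q$. Then \[ S(a/q)=\sum_{j=0}^{\lfloor (k-1)/2\rfloor}\big\lfloor\sqrt{b_{2j+1}}\big\rfloor+E, \] where $0\leq E\leq \tfrac32 k+1$ (in particular $E=O(\log(2+q))$), and $\lfloor x\rfloor$ denotes the integer part of $x$.
   Context: For integers $a,q$ with $q>0$ and $\gcd(a,q)=1$, $S(a/q):=\#\{(m,n)\in\mathbb{Z}^2:\ m>0,\ n>0,\ mn<q,\ am\equiv n \pmod q\}$; this depends only on the rational number $a/q$ and is $1$-periodic in it. The notation $[b_0;b_1,\dots,b_k]$ denotes the finite simple continued fraction $b_0+\cfrac{1}{b_1+\cfrac{1}{\ddots+\cfrac{1}{b_k}}}$ with $b_0\in\mathbb{Z}$ and $b_1,\dots,b_k$ positive integers.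
   Formalization: The bound 0 ≤ E fails exactly when k = 1 and b_1 is a perfect square (e.g. 1/4 = [0;4] has S = 1 but ⌊√4⌋ = 2); the formal statement asserts E = −1 in that case and 0 ≤ E in all others, for both expansions of a/q. *)

theory Defs
  imports Complex_Main
begin

text \<open>\<open>quotient_of r\<close> is the pair of coprime numerator and positive denominator of \<open>r\<close>.
  The set is finite, so \<open>card\<close> is a genuine count: \<open>m\<close> and \<open>n\<close> are both less than \<open>q\<close>.\<close>

definition S_set :: "int \<Rightarrow> int \<Rightarrow> (int \<times> int) set" where
  "S_set a q = {(m, n). m > 0 \<and> n > 0 \<and> m * n < q \<and> (a * m) mod q = n mod q}"

definition S :: "rat \<Rightarrow> nat" where
  "S r = (case quotient_of r of (a, q) \<Rightarrow> card (S_set a q))"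

lemma S_frac:
  assumes "q > 0" "coprime a q"
  shows "S (of_int a / of_int q) = card (S_set a q)"
proof -
  have "quotient_of (of_int a / of_int q) = (a, q)"
    using assms by (simp add: Fract_of_int_quotient [symmetric] quotient_of_Fract
        normalize_def coprime_iff_gcd_eq_1 Let_def)
  then show ?thesis by (simp add: S_def)
qed

lemma finite_S_set: "finite (S_set a q)"
proof (rule finite_subset)
  show "S_set a q \<subseteq> {0..q} \<times> {0..q}"
  proof (clarsimp simp: S_set_def)
    fix m n :: int
    assume h: "m > 0" "n > 0" "m * n < q"
    have "m * 1 \<le> m * n" using h by (intro mult_left_mono) auto
    moreover have "1 * n \<le> m * n" using h by (intro mult_right_mono) auto
    ultimately show "m \<le> q \<and> n \<le> q" using h by linarith
  qed
qed simp

text \<open>The list \<open>[b0, b1, \<dots>, bk]\<close> stands for the continued fraction \<open>[b0; b1, \<dots>, bk]\<close>,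
  so \<open>k\<close> is the length minus one. The value of the empty list is irrelevant.\<close>

fun cfrac :: "int list \<Rightarrow> rat" where
  "cfrac [] = 0"
| "cfrac [b] = of_int b"
| "cfrac (b # c # bs) = of_int b + 1 / cfrac (c # bs)"

text \<open>No condition \<open>bk \<ge> 2\<close> is imposed, so every rational has exactly two expansions, of
  the forms \<open>[b0; \<dots>, bk]\<close> with \<open>k = 0\<close> or \<open>bk \<ge> 2\<close>, and \<open>[b0; \<dots>, bk - 1, 1]\<close>.
  The choice matters in one case: for \<open>q = s\<^sup>2\<close> and \<open>a mod q = 1 mod q\<close>, the expansion
  \<open>[b0; s\<^sup>2]\<close> of \<open>a / q\<close> has \<open>S (a / q) = s - 1 = \<lfloor>sqrt b1\<rfloor> - 1\<close> (e.g. \<open>1 / 4 = [0; 4]\<close>),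
  so the error term is \<open>-1\<close>.\<close>

definition cfrac_expansion :: "rat \<Rightarrow> int list \<Rightarrow> bool" where
  "cfrac_expansion r b \<longleftrightarrow> b \<noteq> [] \<and> (\<forall>i \<in> {1..<length b}. b ! i > 0) \<and> cfrac b = r"

lemma cfrac_expansion_exists:
  "q > 0 \<Longrightarrow> \<exists>b. cfrac_expansion (of_int a / of_int q) b \<and> (length b = 1 \<or> last b \<ge> 2)"
proof (induction "nat q" arbitrary: a q rule: less_induct)
  case less
  define c r where "c = a div q" and "r = a mod q"
  have a: "a = c * q + r" by (simp add: c_def r_def)
  have r: "0 \<le> r" "r < q" using less.prems by (simp_all add: r_def)
  have val: "of_int a / of_int q = (of_int c + of_int r / of_int q :: rat)"
    using less.prems by (simp add: a field_simps)
  show ?case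
  proof (cases "r = 0")
    case True
    then have "cfrac_expansion (of_int a / of_int q) [c]"
      using val by (simp add: cfrac_expansion_def)
    then show ?thesis by (intro exI[of _ "[c]"]) simp
  next
    case False
    with r less.hyps[of r q] obtain b where
      b: "cfrac_expansion (of_int q / of_int r) b" "length b = 1 \<or> last b \<ge> 2"
      by auto
    obtain d ds where bd: "b = d # ds"
      using b(1) by (cases b) (auto simp: cfrac_expansion_def)
    have cb: "cfrac b = of_int q / of_int r" using b(1) by (simp add: cfrac_expansion_def)
    have pos: "x > 0" if "x \<in> set ds" for x
    proof -
      obtain i where "i < length ds" "x = ds ! i" using \<open>x \<in> set ds\<close> by (metis in_set_conv_nth)
      then show ?thesis
        using b(1) unfolding cfrac_expansion_def bd
        by (auto dest: bspec[of _ _ "Suc i"])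
    qed
    have ge1: "cfrac zs \<ge> 1" if "zs \<noteq> []" "\<forall>x\<in>set zs. x > 0" for zs
      using that
    proof (induction zs rule: cfrac.induct)
      case (3 x y zs)
      then have "1 \<le> cfrac (y # zs)" "1 \<le> x" by auto
      then have "(1::rat) \<le> of_int x" "0 \<le> 1 / cfrac (y # zs)" by simp_all
      then have "1 \<le> of_int x + 1 / cfrac (y # zs)" by linarith
      then show ?case by simp
    qed auto
    have gt1: "of_int q / of_int r > (1::rat)" using r False by simp
    have d: "d > 0"
    proof (cases ds)
      case Nil
      then have "(of_int d :: rat) > 1" using cb gt1 bd by simp
      then show ?thesis by simp
    next
      case (Cons y ys)
      then have "cfrac ds \<ge> 1" using ge1[of ds] pos by simp
      then have "1 / cfrac ds \<le> 1" by simp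
      moreover have "of_int d + 1 / cfrac ds > 1" using cb gt1 bd Cons by simp
      ultimately have "(of_int d :: rat) > 0" by linarith
      then show ?thesis by simp
    qed
    have "cfrac (c # b) = of_int a / of_int q"
      using val cb bd by simp
    moreover have "(c # b) ! i > 0" if "i \<in> {1..<length (c # b)}" for i
      using that pos d bd by (auto simp: nth_Cons split: nat.splits)
    ultimately have "cfrac_expansion (of_int a / of_int q) (c # b)"
      by (simp add: cfrac_expansion_def)
    moreover have "last (c # b) \<ge> 2"
    proof (cases ds)
      case Nil
      then have "(of_int d :: rat) > 1" using cb gt1 bd by simp
      then show ?thesis using bd Nil by simp
    next
      case Cons
      then show ?thesis using b(2) bd by simp
    qed
    ultimately show ?thesis by blast
  qed
qed

end

theory Submission
  imports Defs
begin

text \<open>The points \<open>(m, n)\<close> counted by \<open>S (a/q)\<close> lie in the lattice \<open>n \<equiv> a m (mod q)\<close> of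
  determinant \<open>q\<close>. Its positive quadrant is subdivided into unimodular cones by the boundary points
  of the Klein polygon, which are the even convergents \<open>v\<^sub>2\<^sub>j\<close> and the intermediate points
  \<open>v\<^sub>2\<^sub>j + t v\<^sub>2\<^sub>j\<^sub>+\<^sub>1\<close> with \<open>0 < t < b\<^sub>2\<^sub>j\<^sub>+\<^sub>2\<close>. A point \<open>\<alpha> u + \<beta> w\<close> of a unimodular cone has
  \<open>m n \<ge> \<alpha> \<beta> q\<close>, so only multiples of boundary points are counted. Among the intermediate points only
  \<open>t = 1\<close> and \<open>t = b\<^sub>2\<^sub>j\<^sub>+\<^sub>2 - 1\<close> can have \<open>m n < q\<close>, and their proper multiples do not. A multiple
  \<open>d v\<^sub>2\<^sub>j\<close> is counted iff \<open>d\<^sup>2 < b\<^sub>2\<^sub>j\<^sub>+\<^sub>1 + \<epsilon>\<close> with \<open>0 \<le> \<epsilon> \<le> 2\<close>, which gives \<open>\<lfloor>sqrt b\<^sub>2\<^sub>j\<^sub>+\<^sub>1\<rfloor>\<close> or one more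
  when \<open>\<epsilon> > 0\<close>; the case \<open>\<epsilon> = 0\<close> occurs only for \<open>k = 1\<close> and loses one if \<open>b\<^sub>1\<close> is a square.\<close>

section \<open>Continuants of the expansion\<close>

text \<open>Euler's continuants of \<open>bs\<close> and of its tail, built from the front so that
  splitting off leading quotients is a recursion step. The empty list encodes the formal value
  1/0.\<close>

fun cf_num :: "int list \<Rightarrow> int" and cf_den :: "int list \<Rightarrow> int" where
  "cf_num [] = 1"
| "cf_num (b # bs) = b * cf_num bs + cf_den bs"
| "cf_den [] = 0"
| "cf_den (b # bs) = cf_num bs"

lemma cf_num_den_nonneg:
  assumes "\<forall>b\<in>set bs. b > 0"
  shows "cf_num bs > 0 \<and> cf_den bs \<ge> 0"
  using assms by (induction bs) (auto intro: add_pos_nonneg)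

lemma coprime_cf_num_den: "coprime (cf_num bs) (cf_den bs)"
proof (induction bs)
  case (Cons b bs)
  then show ?case
    by (simp add: coprime_iff_gcd_eq_1 gcd.commute)
       (metis gcd.commute gcd_add_mult mult.commute add.commute)
qed simp

lemma cfrac_eq_num_den:
  assumes "bs \<noteq> []" "\<forall>b\<in>set (tl bs). b > 0"
  shows "cfrac bs = of_int (cf_num bs) / of_int (cf_den bs)"
  using assms
proof (induction bs rule: cfrac.induct)
  case (3 b c bs)
  then have pos: "cf_num (c # bs) > 0" using cf_num_den_nonneg[of "c # bs"] by simp
  have IH: "cfrac (c # bs) = of_int (cf_num (c # bs)) / of_int (cf_num bs)" using 3 by simp
  have "cfrac (b # c # bs) = of_int b + of_int (cf_num bs) / of_int (cf_num (c # bs))"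
    by (simp only: cfrac.simps(3) IH) simp
  also have "\<dots> = of_int (cf_num (b # c # bs)) / of_int (cf_den (b # c # bs))"
    using pos by (simp add: field_simps del: cf_num.simps(2)) simp
  finally show ?case .
qed auto

text \<open>Two recursion steps at least double the continuant. This exponential growth makes the
  error term logarithmic in \<open>q\<close>.\<close>

lemma two_power_le_cf_num:
  assumes "\<forall>b\<in>set bs. b > 0" "bs \<noteq> []"
  shows "2 ^ length bs \<le> 2 * (cf_num bs)\<^sup>2"
  using assms
proof (induction bs rule: induct_list012)
  case (2 b)
  then have "1\<^sup>2 \<le> b\<^sup>2" by (intro power_mono) auto
  then show ?case by simp
next
  case (3 b c bs)
  have pos: "cf_num bs > 0" "cf_den bs \<ge> 0" using cf_num_den_nonneg[of bs] 3 by auto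
  have "1 * cf_num bs \<le> c * cf_num bs" using pos 3 by (intro mult_right_mono) auto
  then have le: "cf_num bs \<le> c * cf_num bs + cf_den bs" using pos by linarith
  have "1 * (c * cf_num bs + cf_den bs) \<le> b * (c * cf_num bs + cf_den bs)"
    using pos 3 le by (intro mult_right_mono) auto
  with le have ge: "2 * cf_num bs \<le> cf_num (b # c # bs)" by simp
  then have "(2 * cf_num bs)\<^sup>2 \<le> (cf_num (b # c # bs))\<^sup>2"
    using pos by (intro power_mono) auto
  moreover have "2 ^ length bs \<le> 2 * (cf_num bs)\<^sup>2"
    using 3 by (cases "bs = []") auto
  ultimately show ?case by (simp add: power_mult_distrib)
qed simp

section \<open>Lattice cones and their subdivision\<close>

text \<open>With \<open>v = (x, y)\<close> and \<open>e = (X, -Y)\<close>, the pair \<open>(\<alpha>, \<beta>)\<close> stands for the lattice point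
  \<open>(m, n) = \<alpha> v + \<beta> e\<close>. The cone extends from the ray of \<open>v\<close>, included, to the positive \<open>m\<close>-axis,
  excluded, and the determinant of the lattice is \<open>x Y + X y\<close>.\<close>

definition cone_points :: "int \<Rightarrow> int \<Rightarrow> int \<Rightarrow> int \<Rightarrow> (int \<times> int) set" where
  "cone_points x y X Y = {(\<alpha>, \<beta>). \<beta> \<ge> 0 \<and> \<beta> * Y < \<alpha> * y \<and>
     (\<alpha> * x + \<beta> * X) * (\<alpha> * y - \<beta> * Y) < x * Y + X * y}"

text \<open>With \<open>p\<close> the product of the coordinates of a lattice vector and
  \<open>D\<close> the determinant, these \<open>d\<close> give the multiples of that vector that
  are counted.\<close>

definition ray_multiples :: "int \<Rightarrow> int \<Rightarrow> int set" where
  "ray_multiples p D = {d. d \<ge> 1 \<and> d\<^sup>2 * p < D}"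

text \<open>Both sides name the same points, as \<open>\<alpha> v + \<beta> (e + B v) = (\<alpha> +
  B \<beta>) v + \<beta> e\<close>, and the determinant is unchanged. This absorbs an odd-indexed
  quotient \<open>B\<close>.\<close>

lemma bij_betw_cone_shear:
  "bij_betw (\<lambda>(\<alpha>, \<beta>). (\<alpha> + B * \<beta>, \<beta>)) (cone_points x y (X + B * x) (Y - B * y))
     (cone_points x y X Y)"
  by (rule bij_betw_byWitness[where f' = "\<lambda>(\<alpha>, \<beta>). (\<alpha> - B * \<beta>, \<beta>)"])
     (auto simp: cone_points_def algebra_simps)

text \<open>The cross term with \<open>x2 * y1\<close> suffices, the rest of the expansion being
  nonnegative. Hence no point inside a cone spanned by a lattice basis is counted.\<close>

lemma unimodular_product_ge:
  fixes x1 x2 y1 y2 \<alpha> \<beta> :: int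
  assumes "x1 \<ge> 0" "x2 \<ge> 0" "y1 \<ge> 0" "y2 \<ge> 0" "\<alpha> \<ge> 1" "\<beta> \<ge> 1"
  shows "x2 * y1 - x1 * y2 \<le> (\<alpha> * x1 + \<beta> * x2) * (\<alpha> * y1 + \<beta> * y2)"
proof -
  have "(\<alpha> * x1 + \<beta> * x2) * (\<alpha> * y1 + \<beta> * y2) =
      \<alpha> * \<alpha> * (x1 * y1) + \<beta> * \<beta> * (x2 * y2) + \<alpha> * \<beta> * (x1 * y2) + \<alpha> * \<beta> * (x2 * y1)"
    by (simp add: algebra_simps)
  moreover have "1 * (x2 * y1) \<le> \<alpha> * \<beta> * (x2 * y1)"
    using assms mult_mono[of 1 \<alpha> 1 \<beta>] by (intro mult_right_mono) auto
  moreover have "0 \<le> \<alpha> * \<alpha> * (x1 * y1)" "0 \<le> \<beta> * \<beta> * (x2 * y2)" "0 \<le> \<alpha> * \<beta> * (x1 * y2)" "0 \<le> x1 * y2"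
    using assms by auto
  ultimately show ?thesis by linarith
qed

text \<open>With \<open>s = c - t\<close>, comparing coefficients leaves
  \<open>t + s \<le> \<alpha>\<^sup>2 * (t * s)\<close>. This follows from
  \<open>t + s \<le> 2 * t * s\<close> if \<open>\<alpha> \<ge> 2\<close>, and from
  \<open>(t - 1) * (s - 1) \<ge> 1\<close> otherwise.\<close>

lemma intermediate_product_ge:
  fixes x X y Y c t \<alpha> :: int
  assumes "x \<ge> 0" "X \<ge> 0" "y \<ge> 0" "Y \<ge> 0" "1 \<le> t" "t < c" "\<alpha> \<ge> 1"
    and "\<alpha> \<ge> 2 \<or> t \<noteq> 1 \<and> t \<noteq> c - 1"
  shows "x * Y + X * (y + c * Y) \<le> \<alpha>\<^sup>2 * ((x + t * X) * (y + (c - t) * Y))"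
proof -
  define s where "s = c - t"
  have s: "s \<ge> 1" using assms by (simp add: s_def)
  have sq: "1 \<le> \<alpha>\<^sup>2" using \<open>\<alpha> \<ge> 1\<close> by simp
  have main: "t + s \<le> \<alpha>\<^sup>2 * (t * s)"
  proof (cases "\<alpha> \<ge> 2")
    case True
    then have "2\<^sup>2 \<le> \<alpha>\<^sup>2" by (intro power_mono) auto
    then have "4 * (t * s) \<le> \<alpha>\<^sup>2 * (t * s)" using s assms by (intro mult_right_mono) auto
    moreover have "t * 1 \<le> t * s" "1 * s \<le> t * s"
      using s assms by (auto intro: mult_left_mono mult_right_mono)
    moreover have "0 < t * s" using s assms by simp
    ultimately show ?thesis by linarith
  next
    case False
    then have "t \<ge> 2" "s \<ge> 2" using assms s by (auto simp: s_def)
    then have "1 * 1 \<le> (t - 1) * (s - 1)" by (intro mult_mono) auto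
    then have "t + s \<le> 1 * (t * s)" by (simp add: algebra_simps)
    also have "\<dots> \<le> \<alpha>\<^sup>2 * (t * s)" using sq s assms by (intro mult_right_mono) auto
    finally show ?thesis .
  qed
  have "(t + s) * (X * Y) \<le> \<alpha>\<^sup>2 * (t * s) * (X * Y)"
    using main assms by (intro mult_right_mono) auto
  moreover have "1 * (x * Y) \<le> \<alpha>\<^sup>2 * s * (x * Y)"
    using mult_mono[of 1 "\<alpha>\<^sup>2" 1 s] sq s assms by (intro mult_right_mono) auto
  moreover have "1 * (X * y) \<le> \<alpha>\<^sup>2 * t * (X * y)"
    using mult_mono[of 1 "\<alpha>\<^sup>2" 1 t] sq assms by (intro mult_right_mono) auto
  moreover have "0 \<le> \<alpha>\<^sup>2 * (x * y)" using assms by simp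
  moreover have "\<alpha>\<^sup>2 * ((x + t * X) * (y + s * Y)) =
      \<alpha>\<^sup>2 * (x * y) + \<alpha>\<^sup>2 * s * (x * Y) + \<alpha>\<^sup>2 * t * (X * y) + \<alpha>\<^sup>2 * (t * s) * (X * Y)"
    by (simp add: algebra_simps)
  moreover have "x * Y + X * (y + c * Y) = x * Y + X * y + (t + s) * (X * Y)"
    by (simp add: s_def algebra_simps)
  ultimately show ?thesis unfolding s_def by linarith
qed

text \<open>Division \<open>\<beta> = t * \<alpha> + s\<close> writes the point as
  \<open>(\<alpha> - s) (v + t e) + s (v + (t + 1) e)\<close>, where
  \<open>v = (x, y + c * Y)\<close>. These neighbours span the lattice, so a counted point has
  \<open>s = 0\<close> and is a multiple of an intermediate point.\<close>

lemma sector_points: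
  fixes x X y Y c \<alpha> \<beta> :: int
  assumes nn: "x \<ge> 0" "X \<ge> 0" "y \<ge> 0" "Y \<ge> 0" and "0 < \<beta>" "\<beta> < \<alpha> * c" "c > 0"
    and lt: "(\<alpha> * x + \<beta> * X) * (\<alpha> * (y + c * Y) - \<beta> * Y) < x * Y + X * (y + c * Y)"
  shows "(\<alpha>, \<beta>) \<in> {(1, 1), (1, c - 1)}"
proof -
  have "0 < \<alpha> * c" using assms by linarith
  then have \<alpha>: "\<alpha> > 0" using \<open>c > 0\<close> by (simp add: zero_less_mult_iff)
  define t s where "t = \<beta> div \<alpha>" and "s = \<beta> mod \<alpha>"
  have \<beta>: "\<beta> = t * \<alpha> + s" by (simp add: t_def s_def)
  have s: "0 \<le> s" "s < \<alpha>" using \<alpha> by (simp_all add: s_def)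
  have t0: "t \<ge> 0" using \<alpha> \<open>0 < \<beta>\<close> by (simp add: t_def pos_imp_zdiv_nonneg_iff)
  have "t * \<alpha> < c * \<alpha>" using \<beta> s(1) \<open>\<beta> < \<alpha> * c\<close> mult.commute[of \<alpha> c] by linarith
  then have tc: "t < c" using \<alpha> by simp
  have s0: "s = 0"
  proof (rule ccontr)
    assume "s \<noteq> 0"
    then have "(x + (t + 1) * X) * (y + (c - t) * Y) - (x + t * X) * (y + (c - (t + 1)) * Y) \<le>
       ((\<alpha> - s) * (x + t * X) + s * (x + (t + 1) * X)) *
       ((\<alpha> - s) * (y + (c - t) * Y) + s * (y + (c - (t + 1)) * Y))"
      using s nn t0 tc by (intro unimodular_product_ge) auto
    with lt show False by (simp add: \<beta> algebra_simps)
  qed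
  have t: "t \<ge> 1" using \<beta> s0 t0 \<open>0 < \<beta>\<close> by (cases "t = 0") auto
  have "(\<alpha> * x + \<beta> * X) * (\<alpha> * (y + c * Y) - \<beta> * Y) =
      \<alpha>\<^sup>2 * ((x + t * X) * (y + (c - t) * Y))"
    by (simp add: \<beta> s0 power2_eq_square algebra_simps)
  with lt intermediate_product_ge[of x X y Y t c \<alpha>] nn t tc \<alpha>
  have "\<not> (\<alpha> \<ge> 2 \<or> t \<noteq> 1 \<and> t \<noteq> c - 1)" by linarith
  then show ?thesis using \<alpha> by (auto simp: \<beta> s0)
qed

lemma inj_on_cone_transfer: "inj_on (\<lambda>(\<alpha>, \<beta>). (\<alpha>, \<alpha> * c + \<beta>)) (A :: (int \<times> int) set)"
  by (auto simp: inj_on_def)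

text \<open>The ray of \<open>v + c e = (x + c * X, y)\<close>, the next even convergent, cuts the
  cone. \<open>D\<close> is the ray of \<open>v\<close>, \<open>C\<close> the remaining smaller cone
  rewritten in the basis \<open>v, e\<close>, and the sector between them holds at most two counted
  points.\<close>

lemma cone_decomposition:
  fixes x X y Y c :: int
  assumes "x > 0" "X > 0" "y \<ge> 0" "Y > 0" "c > 0"
  defines "D \<equiv> (\<lambda>d. (d, 0)) ` ray_multiples (x * (y + c * Y)) (x * Y + X * (y + c * Y))"
    and "C \<equiv> (\<lambda>(\<alpha>, \<beta>). (\<alpha>, \<alpha> * c + \<beta>)) ` cone_points (x + c * X) y X Y"
  shows "D \<union> C \<subseteq> cone_points x (y + c * Y) X Y"
    and "cone_points x (y + c * Y) X Y \<subseteq> D \<union> {(1, 1), (1, c - 1)} \<union> C"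
    and "D \<inter> C = {}"
proof -
  have yc: "y + c * Y > 0" using assms by (intro add_nonneg_pos) auto
  show "D \<union> C \<subseteq> cone_points x (y + c * Y) X Y"
  proof (rule Un_least)
    show "D \<subseteq> cone_points x (y + c * Y) X Y"
      unfolding D_def
    proof (rule image_subsetI)
      fix d assume d: "d \<in> ray_multiples (x * (y + c * Y)) (x * Y + X * (y + c * Y))"
      have "0 < d * (y + c * Y)" using d yc by (simp add: ray_multiples_def)
      moreover have "d * x * (d * (y + c * Y)) < x * Y + X * (y + c * Y)"
        using d unfolding ray_multiples_def power2_eq_square by (simp only: mem_Collect_eq ac_simps)
      ultimately show "(d, 0) \<in> cone_points x (y + c * Y) X Y"
        using d by (simp add: ray_multiples_def cone_points_def)
    qed
    show "C \<subseteq> cone_points x (y + c * Y) X Y"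
    proof
      fix p assume "p \<in> C"
      then obtain \<alpha> \<beta> where p: "p = (\<alpha>, \<alpha> * c + \<beta>)" and m: "(\<alpha>, \<beta>) \<in> cone_points (x + c * X) y X Y"
        by (auto simp: C_def)
      have "0 \<le> \<beta> * Y" using m assms by (auto simp: cone_points_def)
      also have "\<dots> < \<alpha> * y" using m by (auto simp: cone_points_def)
      finally have "\<alpha> > 0" using \<open>y \<ge> 0\<close> by (simp add: zero_less_mult_iff)
      then show "p \<in> cone_points x (y + c * Y) X Y"
        using m assms by (simp add: p cone_points_def algebra_simps)
    qed
  qed
  show "cone_points x (y + c * Y) X Y \<subseteq> D \<union> {(1, 1), (1, c - 1)} \<union> C"
  proof
    fix p assume "p \<in> cone_points x (y + c * Y) X Y"
    then obtain \<alpha> \<beta> where p: "p = (\<alpha>, \<beta>)" and m: "(\<alpha>, \<beta>) \<in> cone_points x (y + c * Y) X Y"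
      by (cases p) auto
    \<comment> \<open>On the ray of \<open>v\<close>, strictly between it and the ray of
      \<open>v + c e\<close>, or from the latter ray onwards.\<close>
    consider "\<beta> = 0" | "0 < \<beta>" "\<beta> < \<alpha> * c" | "\<alpha> * c \<le> \<beta>"
      using m by (fastforce simp: cone_points_def)
    then show "p \<in> D \<union> {(1, 1), (1, c - 1)} \<union> C"
    proof cases
      case 1
      then have "\<alpha> > 0" using m yc by (simp add: cone_points_def zero_less_mult_iff)
      then have "\<alpha> \<in> ray_multiples (x * (y + c * Y)) (x * Y + X * (y + c * Y))"
        using 1 m by (simp add: cone_points_def ray_multiples_def power2_eq_square algebra_simps)
      then show ?thesis using 1 by (simp add: p D_def)
    next
      case 2
      then have "(\<alpha>, \<beta>) \<in> {(1, 1), (1, c - 1)}"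
        using m assms(1-5) sector_points[of x X y Y \<beta> \<alpha> c] by (simp add: cone_points_def)
      then show ?thesis unfolding p by blast
    next
      case 3
      then have "(\<alpha>, \<beta> - \<alpha> * c) \<in> cone_points (x + c * X) y X Y"
        using m by (simp add: cone_points_def algebra_simps)
      then have "(\<lambda>(\<alpha>, \<beta>). (\<alpha>, \<alpha> * c + \<beta>)) (\<alpha>, \<beta> - \<alpha> * c) \<in> C"
        unfolding C_def by (rule imageI)
      then show ?thesis by (simp add: p)
    qed
  qed
  show "D \<inter> C = {}"
  proof (rule ccontr)
    assume "D \<inter> C \<noteq> {}"
    then obtain \<alpha> \<beta> where m: "(\<alpha>, \<beta>) \<in> cone_points (x + c * X) y X Y" and e: "\<alpha> * c + \<beta> = 0" "\<alpha> \<ge> 1"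
      by (auto simp: D_def C_def ray_multiples_def)
    have "0 < \<alpha> * c" using e \<open>c > 0\<close> by simp
    then show False using e m by (auto simp: cone_points_def)
  qed
qed

text \<open>When the expansion is exhausted, \<open>e\<close> lies on the \<open>m\<close>-axis and
  the determinant is \<open>X * y\<close>. Any point with \<open>\<beta> \<ge> 1\<close> reaches it
  through its cross term.\<close>

lemma cone_points_last:
  assumes "x \<ge> 0" "X > 0" "y > 0"
  shows "cone_points x y X 0 = (\<lambda>d. (d, 0)) ` ray_multiples (x * y) (X * y)"
proof -
  have "\<beta> = 0" if "\<beta> \<ge> 0" "0 < \<alpha>" "(\<alpha> * x + \<beta> * X) * (\<alpha> * y) < X * y" for \<alpha> \<beta> :: int
  proof (rule ccontr)
    assume "\<beta> \<noteq> 0"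
    then have "1 * (X * y) \<le> \<alpha> * \<beta> * (X * y)"
      using that assms mult_mono[of 1 \<alpha> 1 \<beta>] by (intro mult_right_mono) auto
    moreover have "0 \<le> \<alpha> * \<alpha> * (x * y)" using assms by simp
    moreover have "(\<alpha> * x + \<beta> * X) * (\<alpha> * y) = \<alpha> * \<alpha> * (x * y) + \<alpha> * \<beta> * (X * y)"
      by (simp add: algebra_simps)
    ultimately show False using that by linarith
  qed
  then show ?thesis using assms
    by (fastforce simp: cone_points_def ray_multiples_def zero_less_mult_iff power2_eq_square ac_simps)
qed

section \<open>Counting multiples on a ray\<close>

lemma floor_sqrt_bounds:
  assumes "B > 0"
  defines "r \<equiv> \<lfloor>sqrt (real_of_int B)\<rfloor>"
  shows "r \<ge> 0" "r\<^sup>2 \<le> B" "B < (r + 1)\<^sup>2"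
proof -
  show r0: "r \<ge> 0" using assms by simp
  have "(real_of_int r)\<^sup>2 \<le> (sqrt (real_of_int B))\<^sup>2"
    using r0 unfolding r_def by (intro power_mono) auto
  then have "real_of_int (r\<^sup>2) \<le> real_of_int B" using assms by simp
  then show "r\<^sup>2 \<le> B" by linarith
  have "(sqrt (real_of_int B))\<^sup>2 < (real_of_int r + 1)\<^sup>2"
    using \<open>B > 0\<close> unfolding r_def by (intro power_strict_mono) auto
  then have "real_of_int B < real_of_int ((r + 1)\<^sup>2)" using assms by simp
  then show "B < (r + 1)\<^sup>2" by linarith
qed

text \<open>The condition forces \<open>d\<^sup>2 < B + 2\<close>, whereas
  \<open>(r + 2)\<^sup>2\<close> exceeds \<open>(r + 1)\<^sup>2 > B\<close> by at least 3. The
  excess \<open>c\<close> thus admits at most one extra multiple.\<close>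

lemma ray_multiples_upper:
  assumes "B > 0" "p > 0" "c \<le> 2 * p"
  shows "ray_multiples p (B * p + c) \<subseteq> {1..\<lfloor>sqrt (real_of_int B)\<rfloor> + 1}"
proof
  fix d assume d: "d \<in> ray_multiples p (B * p + c)"
  define r where "r = \<lfloor>sqrt (real_of_int B)\<rfloor>"
  note r = floor_sqrt_bounds[OF \<open>B > 0\<close>, folded r_def]
  have "d\<^sup>2 * p < (B + 2) * p" using d assms by (simp add: ray_multiples_def algebra_simps)
  then have "d\<^sup>2 < B + 2" using \<open>p > 0\<close> by simp
  have "d \<le> r + 1"
  proof (rule ccontr)
    assume "\<not> d \<le> r + 1"
    then have "(r + 2)\<^sup>2 \<le> d\<^sup>2" using r by (intro power_mono) auto
    moreover have "(r + 2)\<^sup>2 = (r + 1)\<^sup>2 + 2 * r + 3" by (simp add: power2_eq_square algebra_simps)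
    ultimately show False using r \<open>d\<^sup>2 < B + 2\<close> by linarith
  qed
  then show "d \<in> {1..\<lfloor>sqrt (real_of_int B)\<rfloor> + 1}" using d by (simp add: ray_multiples_def r_def)
qed

text \<open>From \<open>d \<le> r\<close> comes only \<open>d\<^sup>2 \<le> B\<close>; strictness is
  supplied by a positive \<open>c\<close> or by \<open>B\<close> not being a square.\<close>

lemma ray_multiples_lower:
  assumes "B > 0" "p > 0" "c \<ge> 0" "c > 0 \<or> (\<nexists>s. B = s\<^sup>2)"
  shows "{1..\<lfloor>sqrt (real_of_int B)\<rfloor>} \<subseteq> ray_multiples p (B * p + c)"
proof
  fix d assume d: "d \<in> {1..\<lfloor>sqrt (real_of_int B)\<rfloor>}"
  define r where "r = \<lfloor>sqrt (real_of_int B)\<rfloor>"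
  note r = floor_sqrt_bounds[OF \<open>B > 0\<close>, folded r_def]
  have "d\<^sup>2 \<le> r\<^sup>2" using d by (intro power_mono) (auto simp: r_def)
  then have le: "d\<^sup>2 \<le> B" using r by linarith
  have "d\<^sup>2 * p < B * p + c"
  proof (cases "c > 0")
    case True
    have "d\<^sup>2 * p \<le> B * p" using le \<open>p > 0\<close> by simp
    with True show ?thesis by linarith
  next
    case False
    then have "d\<^sup>2 < B" using le assms by (metis order_le_less)
    then have "d\<^sup>2 * p < B * p" using \<open>p > 0\<close> by simp
    then show ?thesis using \<open>c \<ge> 0\<close> by linarith
  qed
  then show "d \<in> ray_multiples p (B * p + c)" using d by (simp add: ray_multiples_def)
qed

lemma card_ray_multiples:
  assumes "B > 0" "p > 0" "0 \<le> c" "c \<le> 2 * p"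
  shows "finite (ray_multiples p (B * p + c))"
    and "int (card (ray_multiples p (B * p + c))) \<le> \<lfloor>sqrt (real_of_int B)\<rfloor> + 1"
    and "c > 0 \<or> (\<nexists>s. B = s\<^sup>2) \<Longrightarrow>
      \<lfloor>sqrt (real_of_int B)\<rfloor> \<le> int (card (ray_multiples p (B * p + c)))"
proof -
  have r: "\<lfloor>sqrt (real_of_int B)\<rfloor> \<ge> 0" using \<open>B > 0\<close> by simp
  note up = ray_multiples_upper[OF assms(1,2,4)]
  show fin: "finite (ray_multiples p (B * p + c))" using up by (rule finite_subset) simp
  show "int (card (ray_multiples p (B * p + c))) \<le> \<lfloor>sqrt (real_of_int B)\<rfloor> + 1"
    using card_mono[OF finite_atLeastAtMost_int up] r unfolding card_atLeastAtMost_int by linarith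
  show "\<lfloor>sqrt (real_of_int B)\<rfloor> \<le> int (card (ray_multiples p (B * p + c)))"
    if "c > 0 \<or> (\<nexists>s. B = s\<^sup>2)"
    using card_mono[OF fin ray_multiples_lower[OF assms(1-3) that]] r by simp
qed

section \<open>Counting along the expansion\<close>

text \<open>Meant for the list without \<open>b0\<close>, so that the odd-indexed quotients are the
  first, third, and so on.\<close>

fun sqrt_sum :: "int list \<Rightarrow> int" where
  "sqrt_sum [] = 0"
| "sqrt_sum [b] = \<lfloor>sqrt (real_of_int b)\<rfloor>"
| "sqrt_sum (b # c # bs) = \<lfloor>sqrt (real_of_int b)\<rfloor> + sqrt_sum bs"

text \<open>Each pair \<open>B, c\<close> adds at most 1 on the ray of \<open>v\<close> and 2
  intermediate points, hence 3 per two quotients; a final single quotient adds at most 1. The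
  invariant \<open>X \<le> x\<close> bounds the excess on each ray. A square can cost a point only
  if \<open>X = 0\<close> and one quotient remains.\<close>

lemma card_cone_points:
  assumes "\<forall>b\<in>set bs. b > 0" "x > 0" "0 \<le> X" "X \<le> x"
  defines "A \<equiv> cone_points x (cf_den bs) X (cf_num bs)"
  shows "finite A \<and> 2 * int (card A) \<le> 2 * sqrt_sum bs + 3 * int (length bs) \<and>
    (X > 0 \<or> length bs \<noteq> 1 \<or> (\<nexists>s. hd bs = s\<^sup>2) \<longrightarrow> sqrt_sum bs \<le> int (card A))"
  using assms(1-4) unfolding A_def
proof (induction bs arbitrary: x X rule: induct_list012)
  case 1
  have "cone_points x 0 X 1 = {}" by (auto simp: cone_points_def)
  then show ?case by simp
next
  case (2 B)
  have B: "B > 0" using 2 by simp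
  have "X + B * x > 0" using B 2 by (intro add_nonneg_pos) auto
  then have "cone_points x 1 (X + B * x) (B - B * 1) = (\<lambda>d. (d, 0)) ` ray_multiples x (B * x + X)"
    using cone_points_last[of x "X + B * x" 1] 2 by (simp add: add.commute)
  with bij_betw_cone_shear[of B x 1 X B]
  have bij: "bij_betw (\<lambda>(\<alpha>, \<beta>). (\<alpha> + B * \<beta>, \<beta>)) ((\<lambda>d. (d, 0)) ` ray_multiples x (B * x + X)) (cone_points x 1 X B)"
    by simp
  have card: "card (cone_points x 1 X B) = card (ray_multiples x (B * x + X))"
    using bij_betw_same_card[OF bij] by (simp add: card_image inj_on_def)
  note r = card_ray_multiples[of B x X]
  have "finite (cone_points x 1 X B)"
    using bij_betw_finite[OF bij] r 2 by simp
  then show ?case using r 2 card by auto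
next
  case (3 B c bs)
  define y Y where "y = cf_den bs" and "Y = cf_num bs"
  define X' where "X' = X + B * x"
  define p where "p = x * (y + c * Y)"
  define e where "e = x * Y + X * (y + c * Y)"
  have B: "B > 0" and c: "c > 0" and x: "x > 0" and X: "0 \<le> X" "X \<le> x"
    and bs: "\<forall>b\<in>set bs. b > 0" using 3 by auto
  have Y: "Y > 0" and y: "y \<ge> 0" using cf_num_den_nonneg[OF bs] by (auto simp: y_def Y_def)
  have X': "X' > 0" using B x X unfolding X'_def by (intro add_nonneg_pos) auto
  have yc: "y + c * Y > 0" using y Y c by (intro add_nonneg_pos) auto
  have p: "p > 0" using x yc by (simp add: p_def)
  \<comment> \<open>Strict even for \<open>X = 0\<close>, so a square \<open>B\<close> followed by
    another quotient loses nothing.\<close>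
  have e: "e > 0" using x X Y yc unfolding e_def by (intro add_pos_nonneg) auto
  \<comment> \<open>Both summands of \<open>e\<close> are at most \<open>p\<close>: the first
    because \<open>c \<ge> 1\<close>, the second because \<open>X \<le> x\<close>.\<close>
  have "1 * Y \<le> c * Y" using c Y by (intro mult_right_mono) auto
  then have "x * Y \<le> p" using y x unfolding p_def by (intro mult_left_mono) auto
  moreover have "X * (y + c * Y) \<le> p" using X yc unfolding p_def by (intro mult_right_mono) auto
  ultimately have e2: "e \<le> 2 * p" by (simp add: e_def)
  define A0 where "A0 = cone_points x (y + c * Y) X' Y"
  define A1 where "A1 = cone_points (x + c * X') y X' Y"
  define R where "R = ray_multiples p (B * p + e)"
  define D :: "(int \<times> int) set" where "D = (\<lambda>d. (d, 0)) ` R"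
  define C where "C = (\<lambda>(\<alpha>, \<beta>). (\<alpha>, \<alpha> * c + \<beta>)) ` A1"
  have det: "x * Y + X' * (y + c * Y) = B * p + e"
    by (simp add: X'_def p_def e_def algebra_simps)
  note dec = cone_decomposition[OF x X' y Y c, unfolded det, folded p_def,
      folded R_def A0_def A1_def, folded D_def C_def]
  \<comment> \<open>The invariant passes to the smaller cone, and \<open>X' > 0\<close> rules out
    the exceptional case there.\<close>
  have "1 * X' \<le> c * X'" using c X' by (intro mult_right_mono) auto
  then have "X' \<le> x + c * X'" "x + c * X' > 0" using x X' by linarith+
  with 3(1)[of "x + c * X'" X'] bs X'
  have IH: "finite A1" "2 * int (card A1) \<le> 2 * sqrt_sum bs + 3 * int (length bs)"
    "sqrt_sum bs \<le> int (card A1)"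
    by (auto simp: A1_def y_def Y_def)
  note r = card_ray_multiples[OF B p less_imp_le[OF e] e2, folded R_def]
  have fin: "finite D" "finite C" using r IH by (simp_all add: D_def C_def)
  have cardD: "card D = card R" by (simp add: D_def card_image inj_on_def)
  have cardC: "card C = card A1" unfolding C_def by (intro card_image inj_on_cone_transfer)
  have finA0: "finite A0" using dec(2) fin by (auto intro: finite_subset)
  have "card D + card C = card (D \<union> C)" using fin dec(3) by (simp add: card_Un_disjoint)
  also have "\<dots> \<le> card A0" using dec(1) finA0 by (intro card_mono)
  finally have lo: "card D + card C \<le> card A0" .
  have "card A0 \<le> card (D \<union> {(1, 1), (1, c - 1)} \<union> C)"
    using dec(2) fin by (intro card_mono) auto
  also have "\<dots> \<le> card D + card {(1, 1), (1 :: int, c - 1)} + card C"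
    by (meson add_mono card_Un_le le_refl order_trans)
  \<comment> \<open>The two points coincide for \<open>c = 2\<close>; for \<open>c = 1\<close>
    neither lies strictly inside the sector.\<close>
  also have "card {(1, 1), (1 :: int, c - 1)} \<le> 2"
    by (simp add: card_insert_if)
  finally have up: "card A0 \<le> card D + 2 + card C" by simp
  have bij: "bij_betw (\<lambda>(\<alpha>, \<beta>). (\<alpha> + B * \<beta>, \<beta>)) A0 (cone_points x (y + c * Y) X (B * (y + c * Y) + Y))"
    using bij_betw_cone_shear[of B x "y + c * Y" X "B * (y + c * Y) + Y"] by (simp add: A0_def X'_def)
  have eq: "cone_points x (cf_den (B # c # bs)) X (cf_num (B # c # bs)) =
      cone_points x (y + c * Y) X (B * (y + c * Y) + Y)"
    by (simp add: y_def Y_def add.commute)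
  have card: "card (cone_points x (y + c * Y) X (B * (y + c * Y) + Y)) = card A0"
    using bij_betw_same_card[OF bij] by simp
  show ?case unfolding eq card
    using bij_betw_finite[OF bij] finA0 lo up cardD cardC r IH e by auto
qed

section \<open>From \<open>S\<close> to the initial cone, and the index range of the sum\<close>

text \<open>The vectors \<open>v = (1, r)\<close> and \<open>e = (0, -q)\<close> form a basis of the
  lattice. The remainder \<open>r\<close> may equal \<open>q\<close>, as it does for the expansion
  \<open>[b0; 1]\<close>.\<close>

lemma card_S_set_eq_cone_points:
  assumes "0 < q" "a = b * q + r" "0 \<le> r"
  shows "card (S_set a q) = card (cone_points 1 r 0 q)"
proof -
  let ?f = "\<lambda>(\<alpha>, \<beta>). (\<alpha>, \<alpha> * r - \<beta> * q)"
  have "bij_betw ?f (cone_points 1 r 0 q) (S_set a q)"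
    unfolding bij_betw_def
  proof (intro conjI equalityI subsetI)
    show "inj_on ?f (cone_points 1 r 0 q)" using \<open>0 < q\<close> by (auto simp: inj_on_def)
  next
    fix z assume "z \<in> ?f ` cone_points 1 r 0 q"
    then obtain \<alpha> \<beta> where z: "z = (\<alpha>, \<alpha> * r - \<beta> * q)" and m: "(\<alpha>, \<beta>) \<in> cone_points 1 r 0 q"
      by auto
    have "0 \<le> \<beta> * q" "\<beta> * q < \<alpha> * r" using m \<open>0 < q\<close> by (auto simp: cone_points_def)
    then have "0 < \<alpha> * r" by linarith
    then have "\<alpha> > 0" using \<open>0 \<le> r\<close> by (simp add: zero_less_mult_iff)
    moreover have "a * \<alpha> - (\<alpha> * r - \<beta> * q) = q * (b * \<alpha> + \<beta>)"
      by (simp add: assms(2) algebra_simps)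
    then have "(a * \<alpha>) mod q = (\<alpha> * r - \<beta> * q) mod q"
      by (metis dvd_triv_left mod_eq_dvd_iff)
    ultimately show "z \<in> S_set a q" using m by (simp add: z S_set_def cone_points_def)
  next
    fix z assume "z \<in> S_set a q"
    then obtain m n where z: "z = (m, n)" and mn: "m > 0" "n > 0" "m * n < q" "(a * m) mod q = n mod q"
      by (auto simp: S_set_def)
    then obtain k where "a * m - n = q * k" by (metis dvd_def mod_eq_dvd_iff)
    then have n: "n = m * r - (k - b * m) * q" by (simp add: assms(2) algebra_simps)
    \<comment> \<open>A negative coefficient of \<open>e\<close> would push \<open>n\<close> up to
      at least \<open>q\<close>, contradicting \<open>m * n < q\<close>.\<close>
    have "k - b * m \<ge> 0"
    proof (rule ccontr)
      assume "\<not> k - b * m \<ge> 0"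
      then have "(k - b * m) * q \<le> - 1 * q" using \<open>0 < q\<close> by (intro mult_right_mono) auto
      moreover have "0 \<le> m * r" using mn assms by simp
      ultimately have "q \<le> n" using n by linarith
      moreover have "1 * n \<le> m * n" using mn by (intro mult_right_mono) auto
      ultimately show False using mn by linarith
    qed
    then have "(m, k - b * m) \<in> cone_points 1 r 0 q"
      using mn n by (simp add: cone_points_def)
    then have "?f (m, k - b * m) \<in> ?f ` cone_points 1 r 0 q" by (rule imageI)
    then show "z \<in> ?f ` cone_points 1 r 0 q" by (simp add: z n)
  qed
  then show ?thesis by (rule bij_betw_same_card[symmetric])
qed

text \<open>Both sides round down, so \<open>n = 0\<close> yields -1 and an empty index
  range.\<close>

lemma floor_half: "\<lfloor>(real n - 1) / 2\<rfloor> = (int n - 1) div 2"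
  by (metis floor_divide_of_int_eq of_int_1 of_int_diff of_int_numeral of_int_of_nat_eq)

lemma sqrt_sum_eq:
  "(\<Sum>j \<in> {0..\<lfloor>(real (length bs) - 1) / 2\<rfloor>}. \<lfloor>sqrt (real_of_int (bs ! nat (2 * j)))\<rfloor>) = sqrt_sum bs"
  unfolding floor_half
proof (induction bs rule: sqrt_sum.induct)
  case (3 b c bs)
  let ?f = "\<lambda>bs j. \<lfloor>sqrt (real_of_int (bs ! nat (2 * j)))\<rfloor>"
  have "(int (length (b # c # bs)) - 1) div 2 = (int (length bs) - 1) div 2 + 1" by simp
  \<comment> \<open>Shifting \<open>j\<close> by one drops two list entries; \<open>m = - 1\<close>
    covers an empty remaining sum.\<close>
  moreover have "{0..m + 1} = insert 0 ((\<lambda>j. j + 1) ` {0..m})" if "m \<ge> - 1" for m :: int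
    using that by (auto simp: image_iff intro: bexI[of _ "_ - 1"])
  moreover have "(int (length bs) - 1) div 2 \<ge> - 1" by simp
  ultimately have "sum (?f (b # c # bs)) {0..(int (length (b # c # bs)) - 1) div 2} =
     ?f (b # c # bs) 0 + sum (?f (b # c # bs)) ((\<lambda>j. j + 1) ` {0..(int (length bs) - 1) div 2})"
    by (simp add: image_iff)
  also have "sum (?f (b # c # bs)) ((\<lambda>j. j + 1) ` {0..(int (length bs) - 1) div 2}) =
     sum (?f bs) {0..(int (length bs) - 1) div 2}"
    by (subst sum.reindex) (auto intro!: sum.cong simp: nat_add_distrib nat_mult_distrib nth_Cons' numeral_2_eq_2)
  finally show ?case using 3 by simp
qed auto

text \<open>Consecutive continuants are coprime, so two reduced fractions with positive denominators
  are compared.\<close>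

lemma cfrac_expansion_cf_num_den:
  assumes "q > 0" "coprime a q" "cfrac_expansion (of_int a / of_int q) (b # bs)"
  shows "\<forall>c\<in>set bs. c > 0" "cf_num bs = q" "cf_num (b # bs) = a"
proof -
  show pos: "\<forall>c\<in>set bs. c > 0"
  proof
    fix c assume "c \<in> set bs"
    then obtain i where "i < length bs" "c = bs ! i" by (metis in_set_conv_nth)
    then show "c > 0"
      using assms(3) by (auto simp: cfrac_expansion_def dest!: bspec[of _ _ "Suc i"])
  qed
  have num: "cf_num bs > 0" using cf_num_den_nonneg[OF pos] by simp
  have "(of_int a / of_int q :: rat) = of_int (cf_num (b # bs)) / of_int (cf_num bs)"
    using cfrac_eq_num_den[of "b # bs"] pos assms(3) by (simp add: cfrac_expansion_def)
  moreover have "coprime (cf_num (b # bs)) (cf_num bs)"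
    using coprime_cf_num_den[of "b # bs"] by simp
  ultimately have "(a, q) = (cf_num (b # bs), cf_num bs)"
    using assms(1,2) num
    by (metis Fract_of_int_quotient fst_conv normalize_stable quotient_of_Fract snd_conv)
  then show "cf_num bs = q" "cf_num (b # bs) = a" by auto
qed

section \<open>Bounds for the error term\<close>

lemma S_bounds:
  assumes "q > 0" "coprime a q" "cfrac_expansion (of_int a / of_int q) (b # bs)"
  defines "E \<equiv> int (S (of_int a / of_int q)) - sqrt_sum bs"
  shows "2 * E \<le> 3 * int (length bs)"
    and "length bs = 1 \<and> (\<exists>s. hd bs = s\<^sup>2) \<Longrightarrow> E = - 1"
    and "\<not> (length bs = 1 \<and> (\<exists>s. hd bs = s\<^sup>2)) \<Longrightarrow> 0 \<le> E"
proof -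
  note cf = cfrac_expansion_cf_num_den[OF assms(1-3)]
  have a: "a = b * q + cf_den bs" using cf by simp
  have S: "S (of_int a / of_int q) = card (cone_points 1 (cf_den bs) 0 (cf_num bs))"
    using S_frac[OF assms(1,2)] card_S_set_eq_cone_points[OF assms(1) a] cf cf_num_den_nonneg[OF cf(1)]
    by simp
  note c = card_cone_points[OF cf(1), of 1 0, folded S]
  show "2 * E \<le> 3 * int (length bs)" using c by (simp add: E_def)
  show "0 \<le> E" if "\<not> (length bs = 1 \<and> (\<exists>s. hd bs = s\<^sup>2))" using c that by (auto simp: E_def)
  show "E = - 1" if sq: "length bs = 1 \<and> (\<exists>s. hd bs = s\<^sup>2)"
  proof -
    obtain s where "bs = [s\<^sup>2]" using sq by (cases bs) auto
    then obtain t where t: "bs = [t\<^sup>2]" "t \<ge> 0" by (metis abs_ge_zero power2_abs)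
    have "t > 0" using cf(1) t by (cases "t = 0") auto
    \<comment> \<open>Shearing by the only quotient puts \<open>e\<close> on the
      \<open>m\<close>-axis. The count is then of \<open>d \<ge> 1\<close> with
      \<open>d\<^sup>2 < t\<^sup>2\<close>, which misses \<open>d = t\<close>.\<close>
    have "bij_betw (\<lambda>(\<alpha>, \<beta>). (\<alpha> + t\<^sup>2 * \<beta>, \<beta>)) (cone_points 1 1 (t\<^sup>2) 0) (cone_points 1 1 0 (t\<^sup>2))"
      using bij_betw_cone_shear[of "t\<^sup>2" 1 1 0 "t\<^sup>2"] by simp
    then have "S (of_int a / of_int q) = card (cone_points 1 1 (t\<^sup>2) 0)"
      using S t by (simp add: bij_betw_same_card)
    also have "\<dots> = card (ray_multiples 1 (t\<^sup>2))"
      using \<open>t > 0\<close> by (simp add: cone_points_last card_image inj_on_def)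
    also have "ray_multiples 1 (t\<^sup>2) = {1..<t}"
      using \<open>t > 0\<close> by (auto simp: ray_multiples_def power_strict_mono dest: power_less_imp_less_base)
    finally show ?thesis using \<open>t > 0\<close> t by (simp add: E_def)
  qed
qed

lemma length_le_ln_cf_num:
  assumes "\<forall>b\<in>set bs. b > 0"
  shows "real (length bs) * ln 2 \<le> 3 * ln (2 + real_of_int (cf_num bs))"
proof -
  define q where "q = cf_num bs"
  have q: "q > 0" using cf_num_den_nonneg[OF assms] by (simp add: q_def)
  have "2 ^ length bs \<le> 2 * q\<^sup>2"
  proof (cases "bs = []")
    case False
    then show ?thesis using two_power_le_cf_num[OF assms] by (simp add: q_def)
  qed (simp add: q_def)
  \<comment> \<open>The factor 2 is absorbed into a third power, whence the constant 3.\<close>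
  also have "\<dots> \<le> (2 + q) * (2 + q)\<^sup>2"
    using q by (intro mult_mono power_mono) auto
  finally have "2 ^ length bs \<le> (2 + q) ^ 3" by (simp add: power3_eq_cube power2_eq_square)
  then have "real_of_int (2 ^ length bs) \<le> real_of_int ((2 + q) ^ 3)" by (simp only: of_int_le_iff)
  then have "(2::real) ^ length bs \<le> (2 + real_of_int q) ^ 3" by simp
  then have "ln ((2::real) ^ length bs) \<le> ln ((2 + real_of_int q) ^ 3)"
    using q by (subst ln_le_cancel_iff) auto
  then show ?thesis using q by (simp add: ln_realpow q_def)
qed

text \<open>Choosing \<open>E\<close> first, as a function of the expansion, makes the explicit
  bounds and the logarithmic estimate concern the same error term.\<close>

theorem theorem2:
  "\<exists>E :: int list \<Rightarrow> int.
     (\<forall>(a::int) (q::int) (b::int list) (k::nat).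
        q > 0 \<and> a \<noteq> 0 \<and> coprime a q \<and>
        cfrac_expansion (of_int a / of_int q) b \<and> length b = k + 1 \<longrightarrow>
          int (S (of_int a / of_int q)) =
            (\<Sum>j \<in> {0..\<lfloor>(real k - 1) / 2\<rfloor>}. \<lfloor>sqrt (real_of_int (b ! nat (2 * j + 1)))\<rfloor>) + E b \<and>
          (if k = 1 \<and> (\<exists>s::int. b ! 1 = s ^ 2) then E b = - 1 else 0 \<le> E b) \<and>
          real_of_int (E b) \<le> 3 / 2 * real k + 1) \<and>
     (\<exists>C::real. \<forall>(a::int) (q::int) (b::int list).
        q > 0 \<and> a \<noteq> 0 \<and> coprime a q \<and> cfrac_expansion (of_int a / of_int q) b \<longrightarrow>
          \<bar>real_of_int (E b)\<bar> \<le> C * ln (2 + real_of_int q))"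
proof -
  define E :: "int list \<Rightarrow> int" where "E = (\<lambda>b. int (S (cfrac b)) - sqrt_sum (tl b))"
  have main: "int (S (of_int a / of_int q)) =
            (\<Sum>j \<in> {0..\<lfloor>(real k - 1) / 2\<rfloor>}. \<lfloor>sqrt (real_of_int (b ! nat (2 * j + 1)))\<rfloor>) + E b \<and>
          (if k = 1 \<and> (\<exists>s::int. b ! 1 = s ^ 2) then E b = - 1 else 0 \<le> E b) \<and>
          real_of_int (E b) \<le> 3 / 2 * real k"
    and bound: "\<bar>real_of_int (E b)\<bar> \<le> 11 / (2 * ln 2) * ln (2 + real_of_int q)"
    if h: "q > 0" "coprime a q" "cfrac_expansion (of_int a / of_int q) b" and k: "length b = k + 1"
    for a q :: int and b :: "int list" and k :: nat
  proof -
    obtain c bs where b: "b = c # bs" using k by (cases b) auto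
    have len: "length bs = k" using k b by simp
    have E: "E b = int (S (of_int a / of_int q)) - sqrt_sum bs"
      using h(3) by (simp add: E_def b cfrac_expansion_def)
    note bnd = S_bounds[OF h(1,2) h(3)[unfolded b], folded E, unfolded len]
    have nth: "b ! 1 = hd bs" if "k = 1" using that len b by (cases bs) auto
    have "(\<Sum>j \<in> {0..\<lfloor>(real k - 1) / 2\<rfloor>}. \<lfloor>sqrt (real_of_int (b ! nat (2 * j + 1)))\<rfloor>) = sqrt_sum bs"
      unfolding sqrt_sum_eq[symmetric] len
      by (intro sum.cong) (auto simp: b nth_Cons' nat_add_distrib)
    moreover have up: "real_of_int (E b) \<le> 3 / 2 * real k" using bnd(1) by linarith
    moreover have "if k = 1 \<and> (\<exists>s::int. b ! 1 = s ^ 2) then E b = - 1 else 0 \<le> E b"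
      using bnd(2,3) nth by (cases "k = 1 \<and> (\<exists>s. hd bs = s\<^sup>2)") auto
    ultimately show "int (S (of_int a / of_int q)) =
            (\<Sum>j \<in> {0..\<lfloor>(real k - 1) / 2\<rfloor>}. \<lfloor>sqrt (real_of_int (b ! nat (2 * j + 1)))\<rfloor>) + E b \<and>
          (if k = 1 \<and> (\<exists>s::int. b ! 1 = s ^ 2) then E b = - 1 else 0 \<le> E b) \<and>
          real_of_int (E b) \<le> 3 / 2 * real k"
      using E by simp
    note cf = cfrac_expansion_cf_num_den[OF h(1,2) h(3)[unfolded b]]
    have "- 1 \<le> E b" using bnd(2,3) by fastforce
    then have "\<bar>real_of_int (E b)\<bar> \<le> 3 / 2 * real k + 1" using up by linarith
    then have "\<bar>real_of_int (E b)\<bar> * ln 2 \<le> (3 / 2 * real k + 1) * ln 2" by (intro mult_right_mono) auto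
    also have "\<dots> = 3 / 2 * (real k * ln 2) + ln 2" by (simp add: algebra_simps)
    \<comment> \<open>Here 11/2 is 3/2 times 3, from the bound on the length, plus 1 from
      \<open>ln 2 \<le> ln (2 + q)\<close>.\<close>
    also have "\<dots> \<le> 11 / 2 * ln (2 + real_of_int q)"
    proof -
      have "ln 2 \<le> ln (2 + real_of_int q)" using h(1) by simp
      then show ?thesis using length_le_ln_cf_num[OF cf(1)] by (simp add: cf(2) len)
    qed
    finally show "\<bar>real_of_int (E b)\<bar> \<le> 11 / (2 * ln 2) * ln (2 + real_of_int q)"
      by (simp add: field_simps)
  qed
  show ?thesis
  proof (rule exI[of _ E], intro conjI exI[of _ "11 / (2 * ln 2)"] allI impI; elim conjE)
    fix a q :: int and b :: "int list" and k :: nat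
    assume "q > 0" "coprime a q" "cfrac_expansion (of_int a / of_int q) b" "length b = k + 1"
    note m = main[OF this]
    then show "int (S (of_int a / of_int q)) =
       (\<Sum>j \<in> {0..\<lfloor>(real k - 1) / 2\<rfloor>}. \<lfloor>sqrt (real_of_int (b ! nat (2 * j + 1)))\<rfloor>) + E b"
      and "if k = 1 \<and> (\<exists>s::int. b ! 1 = s ^ 2) then E b = - 1 else 0 \<le> E b"
      and "real_of_int (E b) \<le> 3 / 2 * real k + 1"
      by (blast, blast, linarith)
  next
    fix a q :: int and b :: "int list"
    assume h: "q > 0" "coprime a q" "cfrac_expansion (of_int a / of_int q) b"
    then have "length b = (length b - 1) + 1" by (cases b) (auto simp: cfrac_expansion_def)
    with bound[OF h] show "\<bar>real_of_int (E b)\<bar> \<le> 11 / (2 * ln 2) * ln (2 + real_of_int q)" .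
  qed
qed

end
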